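(* Let $X\subseteq\mathbb{R}^n$, let $f$ be a real-valued objective function on $\mathbb{R}^n$, let $g_1(x,u),\dots,g_s(x,u)$ and $h_1(x,u),\dots,h_m(x,u)$ be real functions of $(x,u)\in\mathbb{R}^n\times\mathbb{R}^p$ as in the context, and let $$U(x)=\{u\in\mathbb{R}^p:\ h_1(x,u)\ge 0,\dots,h_m(x,u)\ge 0\}.$$ For each $x\in X$, assume every $g_j(x,u)$ is convex in $u$ and every $h_i(x,u)$ is concave in $u$. Assume that for each $x\in X$ and each $j\in\{1,\dots,s\}$ the optimal value of $$\min_{u}\ g_j(x,u)\quad\text{s.t.}\quad h(x,u)\ge 0$$ is achieved at a KKT point $z_j$. Then the generalized semi-infinite program $$\min\ f(x)\quad\text{s.t.}\quad g_j(x,u)\ge 0\ \ \forall u\in U(x),\ j=1,\dots,s,\quad x\in X$$ is equivalent to the optimization problem $$\begin{array}{cl}\min\limits_{x,z_1,\dots,z_s,\lambda_1,\dots,\lambda_s} & f(x)\\ \text{s.t.} & \nabla_u h(x,z_j)\lambda_j=\nabla_u g_j(x,z_j),\quad j=1,\dots,s,\\ & 0\le h(x,z_j)\perp\lambda_j\ge 0,\quad j=1,\dots,s,\\ & g_j(x,z_j)\ge 0,\quad j=1,\dots,s,\\ & x\in X,\end{array}$$ in the variables $x\in\mathbb{R}^n$, $z_j\in\mathbb{R}^p$, $\lambda_j\in\mathbb{R}^m$; that is, $x$ is feasible for the former if and only if there exist $z_1,\dots,z_s,\lambda_1,\dots,\lambda_s$ such that $(x,z_1,\dots,z_s,\lambda_1,\dots,\lambda_s)$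 is feasible for the latter (so the two problems have the same optimal value and the same minimizing $x$).
   Context: $X\subseteq\mathbb{R}^n$ is given by finitely many polynomial equalities and inequalities and $f$ is a polynomial. The functions $g_j,h_i$ are polynomials, or more generally rational functions, in $(x,u)$; for $x\in X$ they are taken to be defined and differentiable in $u$. Notation: $h(x,u)=(h_1(x,u),\dots,h_m(x,u))^T$; $\nabla_u$ is the gradient in $u$; $\nabla_u h(x,z)=[\nabla_u h_1(x,z)\ \cdots\ \nabla_u h_m(x,z)]\in\mathbb{R}^{p\times m}$ is the transposed Jacobian of $h(x,\cdot)$ at $u=z$. The notation $0\le a\perp b\ge 0$ for vectors $a,b$ means $a\ge 0$, $b\ge 0$ entrywise and $a^Tb=0$. A point $z_j$ is a KKT point of the problem $\min_u g_j(x,u)$ s.t. $h(x,u)\ge 0$ if there exists a Lagrange multiplier vector $\lambda_j\in\mathbb{R}^m$ with $\nabla_u h(x,z_j)\lambda_j=\nabla_u g_j(x,z_j)$ and $0\le h(x,z_j)\perp\lambda_j\ge 0$. *)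

theory Defs
  imports "HOL-Analysis.Analysis"
begin

text \<open>
  Both weak and strict inequalities are allowed; each of the three families may be empty.
\<close>
definition polynomially_described :: "(real^'n) set \<Rightarrow> bool" where
  "polynomially_described X \<longleftrightarrow>
     (\<exists>E I S :: (real^'n \<Rightarrow> real) set.
        finite E \<and> finite I \<and> finite S \<and>
        (\<forall>c \<in> E \<union> I \<union> S. real_polynomial_function c) \<and>
        X = {x. (\<forall>c\<in>E. c x = 0) \<and> (\<forall>c\<in>I. 0 \<le> c x) \<and> (\<forall>c\<in>S. 0 < c x)})"

text \<open>
  A quotient of two polynomials in the joint variable \<open>(x, u)\<close> that is defined, i.e. whose
  denominator does not vanish, for all \<open>x \<in> X\<close> and all \<open>u\<close>; its values for
  \<open>x \<notin> X\<close> are irrelevant. The denominator \<open>1\<close> gives the polynomials.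
\<close>
definition rational_over :: "(real^'n) set \<Rightarrow> (real^'n \<Rightarrow> real^'p \<Rightarrow> real) \<Rightarrow> bool" where
  "rational_over X \<phi> \<longleftrightarrow>
     (\<exists>P Q :: (real^'n) \<times> (real^'p) \<Rightarrow> real.
        real_polynomial_function P \<and> real_polynomial_function Q \<and>
        (\<forall>x\<in>X. \<forall>u. Q (x, u) \<noteq> 0 \<and> \<phi> x u = P (x, u) / Q (x, u)))"

definition gradient :: "(real^'p \<Rightarrow> real) \<Rightarrow> real^'p \<Rightarrow> real^'p" where
  "gradient \<phi> z = (THE D. GDERIV \<phi> z :> D)"

lemma gradient_eqI:
  assumes "GDERIV \<phi> z :> D"
  shows "gradient \<phi> z = D"
  unfolding gradient_def
proof (rule the_equality)
  show "D' = D" if "GDERIV \<phi> z :> D'" for D'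
  proof -
    have "(\<lambda>h. h \<bullet> D') = (\<lambda>h. h \<bullet> D)"
      using assms that unfolding gderiv_def by (rule has_derivative_unique[rotated])
    then show ?thesis
      by (metis vector_eq_ldot)
  qed
qed (fact assms)

text \<open>
  The \<open>p \<times> m\<close> matrix whose \<open>i\<close>-th column is the gradient of \<open>H i\<close>.
\<close>
definition gradient_matrix :: "('m \<Rightarrow> real^'p \<Rightarrow> real) \<Rightarrow> real^'p \<Rightarrow> real^'m^'p" where
  "gradient_matrix H z = (\<chi> k i. gradient (H i) z $ k)"

text \<open>\<open>0 \<le> a \<bottom> b \<ge> 0\<close>; the order on vectors is the entrywise one.\<close>
definition complementary :: "real^'m \<Rightarrow> real^'m \<Rightarrow> bool" where
  "complementary a b \<longleftrightarrow> 0 \<le> a \<and> 0 \<le> b \<and> a \<bullet> b = 0"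

text \<open>
  KKT system for minimizing \<open>\<phi> u\<close> subject to \<open>H i u \<ge> 0\<close> for all \<open>i\<close>,
  at the point \<open>z\<close> with multiplier vector \<open>l\<close>.
\<close>
definition KKT_pair ::
  "(real^'p \<Rightarrow> real) \<Rightarrow> ('m \<Rightarrow> real^'p \<Rightarrow> real) \<Rightarrow> real^'p \<Rightarrow> real^'m \<Rightarrow> bool" where
  "KKT_pair \<phi> H z l \<longleftrightarrow>
     gradient_matrix H z *v l = gradient \<phi> z \<and> complementary (\<chi> i. H i z) l"

definition KKT_point ::
  "(real^'p \<Rightarrow> real) \<Rightarrow> ('m::finite \<Rightarrow> real^'p \<Rightarrow> real) \<Rightarrow> real^'p \<Rightarrow> bool" where
  "KKT_point \<phi> H z \<longleftrightarrow> (\<exists>l :: real^'m. KKT_pair \<phi> H z l)"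

definition U :: "('m \<Rightarrow> real^'n \<Rightarrow> real^'p \<Rightarrow> real) \<Rightarrow> real^'n \<Rightarrow> (real^'p) set" where
  "U h x = {u. \<forall>i. 0 \<le> h i x u}"

definition GSIP_feasible ::
  "(real^'n) set \<Rightarrow> ('s \<Rightarrow> real^'n \<Rightarrow> real^'p \<Rightarrow> real) \<Rightarrow> ('m \<Rightarrow> real^'n \<Rightarrow> real^'p \<Rightarrow> real)
    \<Rightarrow> (real^'n) set" where
  "GSIP_feasible X g h = {x \<in> X. \<forall>j. \<forall>u \<in> U h x. 0 \<le> g j x u}"

definition KKT_feasible ::
  "(real^'n) set \<Rightarrow> ('s \<Rightarrow> real^'n \<Rightarrow> real^'p \<Rightarrow> real) \<Rightarrow> ('m \<Rightarrow> real^'n \<Rightarrow> real^'p \<Rightarrow> real)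
    \<Rightarrow> ((real^'n) \<times> ('s \<Rightarrow> real^'p) \<times> ('s \<Rightarrow> real^'m)) set" where
  "KKT_feasible X g h =
     {(x, z, l). x \<in> X \<and>
        (\<forall>j. KKT_pair (g j x) (\<lambda>i. h i x) (z j) (l j) \<and> 0 \<le> g j x (z j))}"

text \<open>
  Extended reals, so that infeasible (\<open>\<infinity>\<close>) and unbounded (\<open>-\<infinity>\<close>) problems have an optimal value.
\<close>
definition optimal_value :: "('a \<Rightarrow> real) \<Rightarrow> 'a set \<Rightarrow> ereal" where
  "optimal_value F A = (INF a\<in>A. ereal (F a))"

end

theory Submission
  imports Defs
begin

text \<open>
  For convex \<open>\<phi>\<close> and concave \<open>H i\<close>, the tangent inequalities weighted with the multipliers give
  \<open>\<phi> u - \<phi> z \<ge> \<Sum>i. l i * (H i u - H i z) = \<Sum>i. l i * H i u \<ge> 0\<close> for feasible \<open>u\<close>, so a KKT pair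
  certifies a global minimizer. Hence \<open>g j x (z j) \<ge> 0\<close> at a KKT point is the same as
  nonnegativity of \<open>g j x\<close> on \<open>U h x\<close>, and the reformulated feasible set projects onto the
  original one, preserving the objective.
\<close>

text \<open>\<open>gradient\<close> is a definite description, so its defining property requires
  existence. In finite dimension the derivative \<open>D\<close> is the inner product with the
  vector whose coordinates are the values of \<open>D\<close> on the orthonormal basis.\<close>

lemma GDERIV_gradient:
  fixes \<phi> :: "real^'p \<Rightarrow> real"
  assumes "\<phi> differentiable (at z)"
  shows "GDERIV \<phi> z :> gradient \<phi> z"
proof -
  obtain D where D: "(\<phi> has_derivative D) (at z)"
    using assms unfolding differentiable_def by blast
  interpret bounded_linear D
    using D by (rule has_derivative_bounded_linear)
  have "D v = v \<bullet> (\<Sum>b\<in>Basis. D b *\<^sub>R b)" for v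
  proof -
    have "D v = D (\<Sum>b\<in>Basis. (v \<bullet> b) *\<^sub>R b)"
      by (simp add: euclidean_representation)
    also have "\<dots> = (\<Sum>b\<in>Basis. (v \<bullet> b) * D b)"
      by (simp add: sum scaleR)
    finally show ?thesis
      by (simp add: inner_sum_right mult.commute)
  qed
  then have "D = (\<lambda>v. v \<bullet> (\<Sum>b\<in>Basis. D b *\<^sub>R b))"
    by blast
  with D have "GDERIV \<phi> z :> (\<Sum>b\<in>Basis. D b *\<^sub>R b)"
    unfolding gderiv_def by metis
  then show ?thesis
    by (simp add: gradient_eqI)
qed

text \<open>Restricting \<open>\<phi>\<close> to the line through \<open>z\<close> and
  \<open>u\<close> reduces this to the tangent inequality for a convex function of one real
  variable.\<close>

lemma convex_on_above_gradient:
  fixes \<phi> :: "'a::real_inner \<Rightarrow> real"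
  assumes "convex_on UNIV \<phi>" and "GDERIV \<phi> z :> D"
  shows "(u - z) \<bullet> D \<le> \<phi> u - \<phi> z"
proof -
  define \<psi> where "\<psi> t = \<phi> (z + t *\<^sub>R (u - z))" for t
  have "convex_on UNIV \<psi>"
  proof (rule convex_onI)
    fix t x y :: real
    assume t: "0 < t" "t < 1"
    have "z + ((1 - t) *\<^sub>R x + t *\<^sub>R y) *\<^sub>R (u - z)
        = (1 - t) *\<^sub>R (z + x *\<^sub>R (u - z)) + t *\<^sub>R (z + y *\<^sub>R (u - z))"
      by (simp add: algebra_simps)
    then show "\<psi> ((1 - t) *\<^sub>R x + t *\<^sub>R y) \<le> (1 - t) * \<psi> x + t * \<psi> y"
      unfolding \<psi>_def using convex_onD[OF assms(1)] t by simp
  qed simp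
  moreover have "(\<psi> has_field_derivative (u - z) \<bullet> D) (at 0)"
  proof -
    have "((\<lambda>t. z + t *\<^sub>R (u - z)) has_derivative (\<lambda>t. t *\<^sub>R (u - z))) (at 0)"
      by (auto intro!: derivative_eq_intros)
    \<comment> \<open>The base point is written as the value of the inner affine map at 0, the form
      in which the chain rule expects it.\<close>
    moreover have "(\<phi> has_derivative (\<lambda>v. v \<bullet> D)) (at (z + 0 *\<^sub>R (u - z)))"
      using assms(2) by (simp add: gderiv_def)
    ultimately have "(\<psi> has_derivative (\<lambda>t. t *\<^sub>R (u - z) \<bullet> D)) (at 0)"
      unfolding \<psi>_def by (rule has_derivative_compose)
    then show ?thesis
      by (simp add: has_field_derivative_def mult.commute[of _ "(u - z) \<bullet> D"])
  qed
  \<comment> \<open>The tangent at 0 is compared with \<open>\<psi>\<close> at 1, where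
    \<open>\<psi> 0 = \<phi> z\<close> and \<open>\<psi> 1 = \<phi> u\<close>.\<close>
  ultimately have "((u - z) \<bullet> D) * (1 - 0) \<le> \<psi> 1 - \<psi> 0"
    by (intro convex_on_imp_above_tangent[where A = UNIV]) auto
  then show ?thesis
    by (simp add: \<psi>_def)
qed

lemma KKT_pair_minimal:
  fixes \<phi> :: "real^'p \<Rightarrow> real" and H :: "'m::finite \<Rightarrow> real^'p \<Rightarrow> real"
  assumes \<phi>: "convex_on UNIV \<phi>" "\<phi> differentiable (at z)"
    and H: "\<And>i. concave_on UNIV (H i)" "\<And>i. H i differentiable (at z)"
    and KKT: "KKT_pair \<phi> H z l"
    and u: "\<And>i. 0 \<le> H i u"
  shows "\<phi> z \<le> \<phi> u"
proof -
  have l: "0 \<le> l $ i" for i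
    using KKT by (simp add: KKT_pair_def complementary_def less_eq_vec_def)
  have comp: "(\<Sum>i\<in>UNIV. l $ i * H i z) = 0"
    using KKT by (simp add: KKT_pair_def complementary_def inner_vec_def mult.commute)
  \<comment> \<open>A matrix times a vector is the combination of the columns, here the constraint
    gradients.\<close>
  have "gradient \<phi> z = (\<Sum>i\<in>UNIV. l $ i *\<^sub>R gradient (H i) z)"
    using KKT by (simp add: KKT_pair_def gradient_matrix_def matrix_vector_mult_def vec_eq_iff
        mult.commute)
  then have grad: "(u - z) \<bullet> gradient \<phi> z = (\<Sum>i\<in>UNIV. l $ i * ((u - z) \<bullet> gradient (H i) z))"
    by (simp add: inner_sum_right)
  have tangent: "H i u - H i z \<le> (u - z) \<bullet> gradient (H i) z" for i
  proof -
    \<comment> \<open>Concavity is convexity of the negative, which reverses the tangent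
      inequality.\<close>
    have "GDERIV (\<lambda>v. - H i v) z :> - gradient (H i) z"
      using GDERIV_gradient[OF H(2)] by (rule GDERIV_minus)
    then have "(u - z) \<bullet> - gradient (H i) z \<le> - H i u - - H i z"
      using H(1) by (intro convex_on_above_gradient) (simp_all add: concave_on_def)
    then show ?thesis
      by simp
  qed
  have "0 \<le> (\<Sum>i\<in>UNIV. l $ i * H i u)"
    using l u by (simp add: sum_nonneg)
  also have "\<dots> = (\<Sum>i\<in>UNIV. l $ i * (H i u - H i z))"
    using comp by (simp add: right_diff_distrib sum_subtractf)
  also have "\<dots> \<le> (u - z) \<bullet> gradient \<phi> z"
    unfolding grad by (intro sum_mono mult_left_mono tangent l)
  also have "\<dots> \<le> \<phi> u - \<phi> z"
    using \<phi>(1) GDERIV_gradient[OF \<phi>(2)] by (rule convex_on_above_gradient)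
  finally show ?thesis
    by simp
qed

text \<open>\<open>A\<close> is the projection of \<open>B\<close>, and the objective ignores
  \<open>z\<close> and \<open>l\<close>, so both infima range over the same set of values.\<close>

lemma optimal_value_lift:
  assumes "\<And>x. x \<in> A \<longleftrightarrow> (\<exists>z l. (x, z, l) \<in> B)"
  shows "optimal_value f A = optimal_value (\<lambda>(x, z, l). f x) B"
proof -
  have "A = fst ` B"
    using assms by force
  then show ?thesis
    by (simp add: optimal_value_def image_image case_prod_unfold)
qed

lemma is_arg_min_lift:
  assumes "\<And>x. x \<in> A \<longleftrightarrow> (\<exists>z l. (x, z, l) \<in> B)"
  shows "is_arg_min f (\<lambda>x. x \<in> A) x \<longleftrightarrow>
    (\<exists>z l. is_arg_min (\<lambda>(x, z, l). f x) (\<lambda>w. w \<in> B) (x, z, l))"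
  using assms by (auto simp: is_arg_min_def)

theorem theorem5p1:
  fixes X :: "(real^'n) set"
    and f :: "real^'n \<Rightarrow> real"
    and g :: "'s::finite \<Rightarrow> real^'n \<Rightarrow> real^'p \<Rightarrow> real"
    and h :: "'m::finite \<Rightarrow> real^'n \<Rightarrow> real^'p \<Rightarrow> real"
  assumes X: "polynomially_described X"
    and f: "real_polynomial_function f"
    and g_rational: "\<And>j. rational_over X (g j)"
    and h_rational: "\<And>i. rational_over X (h i)"
    and g_differentiable: "\<And>x j u. x \<in> X \<Longrightarrow> g j x differentiable (at u)"
    and h_differentiable: "\<And>x i u. x \<in> X \<Longrightarrow> h i x differentiable (at u)"
    and g_convex: "\<And>x j. x \<in> X \<Longrightarrow> convex_on UNIV (g j x)"
    and h_concave: "\<And>x i. x \<in> X \<Longrightarrow> concave_on UNIV (h i x)"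
    and achieved: "\<And>x j. x \<in> X \<Longrightarrow>
           \<exists>z. is_arg_min (g j x) (\<lambda>u. u \<in> U h x) z \<and> KKT_point (g j x) (\<lambda>i. h i x) z"
  shows "(\<forall>x. x \<in> GSIP_feasible X g h \<longleftrightarrow> (\<exists>z l. (x, z, l) \<in> KKT_feasible X g h)) \<and>
         optimal_value f (GSIP_feasible X g h) =
           optimal_value (\<lambda>(x, z, l). f x) (KKT_feasible X g h) \<and>
         (\<forall>x. is_arg_min f (\<lambda>x. x \<in> GSIP_feasible X g h) x \<longleftrightarrow>
            (\<exists>z l. is_arg_min (\<lambda>(x, z, l). f x) (\<lambda>w. w \<in> KKT_feasible X g h) (x, z, l)))"
proof -
  have feas: "x \<in> GSIP_feasible X g h \<longleftrightarrow> (\<exists>z l. (x, z, l) \<in> KKT_feasible X g h)" for x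
  proof
    assume x: "x \<in> GSIP_feasible X g h"
    then have "x \<in> X"
      by (simp add: GSIP_feasible_def)
    \<comment> \<open>The attained minimizer lies in \<open>U h x\<close>, so feasibility of
      \<open>x\<close> makes its value nonnegative; being a KKT point, it comes with a
      multiplier.\<close>
    have "\<exists>z l. KKT_pair (g j x) (\<lambda>i. h i x) z l \<and> 0 \<le> g j x z" for j
      using achieved[OF \<open>x \<in> X\<close>, of j] x
      by (auto simp: KKT_point_def is_arg_min_def GSIP_feasible_def)
    then obtain z l where "\<And>j. KKT_pair (g j x) (\<lambda>i. h i x) (z j) (l j) \<and> 0 \<le> g j x (z j)"
      by metis
    with \<open>x \<in> X\<close> show "\<exists>z l. (x, z, l) \<in> KKT_feasible X g h"
      by (auto simp: KKT_feasible_def)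
  next
    assume "\<exists>z l. (x, z, l) \<in> KKT_feasible X g h"
    then obtain z l where "x \<in> X"
      and KKT: "\<And>j. KKT_pair (g j x) (\<lambda>i. h i x) (z j) (l j)"
      and nonneg: "\<And>j. 0 \<le> g j x (z j)"
      by (auto simp: KKT_feasible_def)
    have "0 \<le> g j x u" if "u \<in> U h x" for j u
    proof -
      \<comment> \<open>Here \<open>z j\<close> is an arbitrary KKT point, not the one from
        \<open>achieved\<close>; convexity makes it a global minimizer.\<close>
      have "g j x (z j) \<le> g j x u"
        using \<open>x \<in> X\<close> that
        by (intro KKT_pair_minimal[OF _ _ _ _ KKT] g_convex g_differentiable h_concave
            h_differentiable) (auto simp: U_def)
      with nonneg[of j] show ?thesis
        by linarith
    qed
    with \<open>x \<in> X\<close> show "x \<in> GSIP_feasible X g h"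
      by (simp add: GSIP_feasible_def)
  qed
  then show ?thesis
    using optimal_value_lift[OF feas] is_arg_min_lift[OF feas] by blast
qed

end
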